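(* For all integers $n\ge k\ge 1$, $$\mathrm{op}_{n,k}(321)=(-1)^{k-1}k+\sum_{j=0}^{k-2}(-1)^{k-j}\binom{k}{j+2}2^{n-2j}\sum_{i=0}^{j}\frac{2j-2i+1}{j+1}\binom{2i}{i}\binom{2(j-i)}{j-i}\binom{n+2i}{2i}.$$
   Context: An ordered partition of $[n]=\{1,\dots,n\}$ into $k$ blocks is a sequence $\pi=B_1/B_2/\cdots/B_k$ of nonempty pairwise disjoint subsets with union $[n]$. It contains the pattern $321$ if there exist $1\le i_1<i_2<i_3\le k$ and $b_1\in B_{i_1}$, $b_2\in B_{i_2}$, $b_3\in B_{i_3}$ with $b_1>b_2>b_3$; otherwise it avoids $321$. $\mathrm{op}_{n,k}(321)$ is the number of ordered partitions of $[n]$ into $k$ blocks that avoid $321$. An empty sum (here, when $k=1$) equals $0$. *)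

theory Defs
  imports Complex_Main
begin

text \<open>
  An ordered partition \<open>B\<^sub>1/\<dots>/B\<^sub>k\<close> of \<open>{1..n}\<close> is a list of blocks; the block \<open>B\<^sub>i\<close> is the list
  entry with index \<open>i - 1\<close>.
\<close>

definition ordered_partition :: "nat \<Rightarrow> nat \<Rightarrow> nat set list \<Rightarrow> bool" where
  "ordered_partition n k Bs \<longleftrightarrow>
     length Bs = k \<and>
     (\<forall>i<k. Bs ! i \<noteq> {}) \<and>
     (\<forall>i<k. \<forall>j<k. i \<noteq> j \<longrightarrow> Bs ! i \<inter> Bs ! j = {}) \<and>
     (\<Union>i<k. Bs ! i) = {1..n}"

definition contains_321 :: "nat set list \<Rightarrow> bool" where
  "contains_321 Bs \<longleftrightarrow>
     (\<exists>i1 i2 i3. i1 < i2 \<and> i2 < i3 \<and> i3 < length Bs \<and>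
        (\<exists>b1 \<in> Bs ! i1. \<exists>b2 \<in> Bs ! i2. \<exists>b3 \<in> Bs ! i3. b1 > b2 \<and> b2 > b3))"

definition op_321 :: "nat \<Rightarrow> nat \<Rightarrow> nat" where
  "op_321 n k = card {Bs. ordered_partition n k Bs \<and> \<not> contains_321 Bs}"

lemma finite_ordered_partitions: "finite {Bs. ordered_partition n k Bs}"
proof (rule finite_subset)
  show "{Bs. ordered_partition n k Bs} \<subseteq> {Bs. set Bs \<subseteq> Pow {1..n} \<and> length Bs = k}"
    unfolding ordered_partition_def by (fastforce simp: in_set_conv_nth)
  show "finite {Bs. set Bs \<subseteq> Pow {1..n} \<and> length Bs = k}"
    by (rule finite_lists_length_eq) simp
qed

end

theory Submission
  imports Defs "HOL-Library.Infinite_Set" "HOL-Computational_Algebra.Formal_Power_Series"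
begin

unbundle fps_syntax

text \<open>
  An ordered partition of \<open>{1..n}\<close> into \<open>k\<close> blocks is a surjective word of length \<open>n\<close> over \<open>k\<close>
  letters, and it avoids 321 exactly when the word has no strictly decreasing triple of letters.
  Inclusion-exclusion over the set of letters that occur expresses \<open>op_321 n k\<close> by the numbers
  \<open>W n m\<close> of all 321-avoiding words of length \<open>n\<close> over \<open>m\<close> letters
  (\<open>op_321_inclusion_exclusion\<close>); it accounts for the outer alternating sum with its binomial
  coefficients. What remains is a closed formula for \<open>W n m\<close>.

  Reading a word from left to right and remembering two letters yields a linear recurrence for the
  number of admissible continuations (\<open>card_scan_ok\<close>). In generating functions, with \<open>X\<close> marking
  the length and \<open>Y\<close> the letters above the current maximum, it has constant coefficients in the
  number \<open>a\<close> of letters from the smaller remembered one up to below the larger, so it has a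
  solution of the form \<open>H * \<rho> ^ a\<close> (\<open>kernel_root\<close>). Here \<open>H\<close> is the generating function of the
  numbers \<open>W n (m + 1)\<close>, the coefficients of \<open>X ^ n * Y ^ m\<close>, and the power series solution of
  \<open>H = 1 / (1 - Y) + X (1 - X) H\<^sup>2\<close>.

  The closed formula satisfies the same quadratic equation (\<open>words_fps_quadratic\<close>): solving it gives
  \<open>1 - 2 X (1 - X) H = sqrt (((1 - 2 X)\<^sup>2 - Y) / (1 - Y))\<close>, whose derivative in \<open>Y\<close> is up to a factor
  the product of the inverse square root of \<open>1 - Y / (1 - 2 X)\<^sup>2\<close> and the inverse cube of the
  square root of \<open>1 - Y\<close>. The double sum with its central binomial coefficients is the Cauchy product
  of these two series. The argument runs from the formula to the recurrence: the generating function of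
  the formula supplies \<open>H\<close>, and the recurrence determines its solution.
\<close>

section \<open>Ordered partitions as words\<close>

definition avoids_321 :: "nat list \<Rightarrow> bool" where
  "avoids_321 w \<longleftrightarrow>
     \<not> (\<exists>i j l. i < j \<and> j < l \<and> l < length w \<and> w ! i > w ! j \<and> w ! j > w ! l)"

text \<open>
  A surjective word \<open>w\<close> stands for the ordered partition that puts \<open>b\<close> into block \<open>w ! (b - 1)\<close>.
\<close>
definition blocks :: "nat \<Rightarrow> nat list \<Rightarrow> nat set list" where
  "blocks k w = map (\<lambda>i. {b \<in> {1..length w}. w ! (b - 1) = i}) [0..<k]"

lemma in_blocks_iff:
  "i < k \<Longrightarrow> b \<in> blocks k w ! i \<longleftrightarrow> 1 \<le> b \<and> b \<le> length w \<and> w ! (b - 1) = i"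
  by (auto simp: blocks_def)

text \<open>
  Passing from blocks to letters swaps the roles of position and value: the elements
  \<open>b\<^sub>1 > b\<^sub>2 > b\<^sub>3\<close> in later and later blocks become three positions, read from the last to the first,
  whose letters decrease from left to right.
\<close>
lemma contains_321_blocks_iff:
  assumes "set w = {..<k}"
  shows "contains_321 (blocks k w) \<longleftrightarrow> \<not> avoids_321 w"
proof
  assume "contains_321 (blocks k w)"
  then obtain i1 i2 i3 b1 b2 b3 where i: "i1 < i2" "i2 < i3" "i3 < k"
    and b: "b1 \<in> blocks k w ! i1" "b2 \<in> blocks k w ! i2" "b3 \<in> blocks k w ! i3"
      "b1 > b2" "b2 > b3"
    by (auto simp: contains_321_def blocks_def)
  have "b3 - 1 < b2 - 1 \<and> b2 - 1 < b1 - 1 \<and> b1 - 1 < length w \<and>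
      w ! (b3 - 1) > w ! (b2 - 1) \<and> w ! (b2 - 1) > w ! (b1 - 1)"
    using i b by (simp add: in_blocks_iff) linarith
  then show "\<not> avoids_321 w"
    unfolding avoids_321_def by blast
next
  assume "\<not> avoids_321 w"
  then obtain i j l where ijl: "i < j" "j < l" "l < length w" "w ! i > w ! j" "w ! j > w ! l"
    by (auto simp: avoids_321_def)
  have "w ! i < k"
    using assms ijl nth_mem[of i w] by auto
  then have "w ! l < w ! j \<and> w ! j < w ! i \<and> w ! i < length (blocks k w) \<and>
      Suc l \<in> blocks k w ! (w ! l) \<and> Suc j \<in> blocks k w ! (w ! j) \<and>
      Suc i \<in> blocks k w ! (w ! i) \<and>
      Suc l > Suc j \<and> Suc j > Suc i"
    using ijl by (auto simp: in_blocks_iff blocks_def)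
  then show "contains_321 (blocks k w)"
    unfolding contains_321_def by blast
qed

lemma ordered_partition_blocks:
  assumes "set w = {..<k}"
  shows "ordered_partition (length w) k (blocks k w)"
  unfolding ordered_partition_def
proof (intro conjI allI impI)
  show "length (blocks k w) = k"
    by (simp add: blocks_def)
  fix i assume i: "i < k"
  then obtain p where "p < length w" "w ! p = i"
    using assms by (metis in_set_conv_nth lessThan_iff)
  then have "Suc p \<in> blocks k w ! i"
    using i by (simp add: in_blocks_iff)
  then show "blocks k w ! i \<noteq> {}"
    by blast
  show "blocks k w ! i \<inter> blocks k w ! j = {}" if "j < k" "i \<noteq> j" for j
    using i that by (auto simp: in_blocks_iff)
next
  have "w ! (b - 1) < k" if "1 \<le> b" "b \<le> length w" for b
    using assms that nth_mem[of "b - 1" w] by auto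
  then show "(\<Union>i<k. blocks k w ! i) = {1..length w}"
    by (auto simp: in_blocks_iff)
qed

lemma bij_betw_blocks:
  "bij_betw (blocks k) {w. length w = n \<and> set w = {..<k}} {Bs. ordered_partition n k Bs}"
  unfolding bij_betw_def
proof
  show "inj_on (blocks k) {w. length w = n \<and> set w = {..<k}}"
  proof (rule inj_onI)
    fix w w'
    assume w: "w \<in> {w. length w = n \<and> set w = {..<k}}"
      and w': "w' \<in> {w. length w = n \<and> set w = {..<k}}"
      and eq: "blocks k w = blocks k w'"
    show "w = w'"
    proof (rule nth_equalityI)
      show "length w = length w'"
        using w w' by simp
      fix p assume p: "p < length w"
      have k: "w ! p < k"
        using w p nth_mem[of p w] by auto
      have "Suc p \<in> blocks k w ! (w ! p)"
        using p k by (simp add: in_blocks_iff)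
      then show "w ! p = w' ! p"
        using k by (simp add: eq in_blocks_iff)
    qed
  qed
  show "blocks k ` {w. length w = n \<and> set w = {..<k}} = {Bs. ordered_partition n k Bs}"
  proof (intro equalityI subsetI)
    fix Bs assume "Bs \<in> {Bs. ordered_partition n k Bs}"
    then have len: "length Bs = k" and ne: "\<And>i. i < k \<Longrightarrow> Bs ! i \<noteq> {}"
      and disj: "\<And>i j. \<lbrakk>i < k; j < k; i \<noteq> j\<rbrakk> \<Longrightarrow> Bs ! i \<inter> Bs ! j = {}"
      and cover: "(\<Union>i<k. Bs ! i) = {1..n}"
      by (auto simp: ordered_partition_def)
    have "\<forall>p. \<exists>i. p < n \<longrightarrow> i < k \<and> Suc p \<in> Bs ! i"
    proof (intro allI)
      fix p
      have "p < n \<Longrightarrow> Suc p \<in> (\<Union>i<k. Bs ! i)"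
        unfolding cover by auto
      then show "\<exists>i. p < n \<longrightarrow> i < k \<and> Suc p \<in> Bs ! i"
        by auto
    qed
    then obtain f where f: "\<And>p. p < n \<Longrightarrow> f p < k \<and> Suc p \<in> Bs ! f p"
      by metis
    have unique: "f p = i" if "p < n" "i < k" "Suc p \<in> Bs ! i" for p i
      using f[OF that(1)] disj[of "f p" i] that by blast
    define w where "w = map f [0..<n]"
    have pos: "\<exists>p. b = Suc p \<and> p < n" if "i < k" "b \<in> Bs ! i" for i b
    proof -
      have "b \<in> {1..n}"
        using that cover by blast
      then show ?thesis
        by (cases b) auto
    qed
    have "set w = {..<k}"
    proof (intro equalityI subsetI)
      show "i \<in> {..<k}" if "i \<in> set w" for i
        using that f by (auto simp: w_def)
      show "i \<in> set w" if "i \<in> {..<k}" for i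
      proof -
        have i: "i < k"
          using that by simp
        then obtain b where b: "b \<in> Bs ! i"
          using ne[of i] by auto
        obtain p where p: "b = Suc p" "p < n"
          using pos[OF i b] by auto
        then have "f p = i"
          using unique[of p i] i b by simp
        then show ?thesis
          using p by (auto simp: w_def)
      qed
    qed
    moreover have "blocks k w = Bs"
    proof (rule nth_equalityI)
      show "length (blocks k w) = length Bs"
        by (simp add: blocks_def len)
      fix i assume "i < length (blocks k w)"
      then have i: "i < k"
        by (simp add: blocks_def)
      show "blocks k w ! i = Bs ! i"
      proof (intro equalityI subsetI)
        fix b assume "b \<in> blocks k w ! i"
        then have b: "1 \<le> b" "b \<le> n" "w ! (b - 1) = i"
          using i by (auto simp: in_blocks_iff w_def)
        then have "f (b - 1) = i"
          by (simp add: w_def)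
        then show "b \<in> Bs ! i"
          using f[of "b - 1"] b by simp
      next
        fix b assume b: "b \<in> Bs ! i"
        then obtain p where p: "b = Suc p" "p < n"
          using pos[OF i b] by auto
        then show "b \<in> blocks k w ! i"
          using unique[of p i] b i by (simp add: in_blocks_iff w_def)
      qed
    qed
    ultimately show "Bs \<in> blocks k ` {w. length w = n \<and> set w = {..<k}}"
      by (auto simp: w_def)
  qed (use ordered_partition_blocks in auto)
qed

lemma op_321_eq_card_words:
  "op_321 n k = card {w. length w = n \<and> set w = {..<k} \<and> avoids_321 w}"
proof -
  have "bij_betw (blocks k) {w. length w = n \<and> set w = {..<k} \<and> avoids_321 w}
      {Bs. ordered_partition n k Bs \<and> \<not> contains_321 Bs}"
    using bij_betw_blocks[of k n]
    unfolding bij_betw_def inj_on_def image_def by (simp; fastforce simp: contains_321_blocks_iff)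
  then show ?thesis
    unfolding op_321_def by (simp add: bij_betw_same_card)
qed

lemma finite_words: "finite S \<Longrightarrow> finite {w. length w = n \<and> set w \<subseteq> S \<and> P w}"
  using finite_lists_length_eq[of S n] by (auto elim: rev_finite_subset)

text \<open>The letters are renamed by the increasing bijection, which respects the pattern.\<close>
lemma card_words_depends_on_card_letters:
  assumes "finite S"
  shows "card {w. length w = n \<and> set w \<subseteq> S \<and> avoids_321 w} =
      card {w. length w = n \<and> set w \<subseteq> {..<card S} \<and> avoids_321 w}" (is "card ?S = card ?T")
proof -
  obtain h where bij: "bij_betw h {..<card S} S" and mono: "strict_mono_on {..<card S} h"
    using ex_bij_betw_strict_mono_card[OF assms] .
  have less: "h x < h y \<longleftrightarrow> x < y" if "x < card S" "y < card S" for x y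
    using mono that by (metis lessThan_iff linorder_neqE_nat not_less_iff_gr_or_eq strict_mono_onD)
  have avoids: "avoids_321 (map h w) \<longleftrightarrow> avoids_321 w" if "set w \<subseteq> {..<card S}" for w
  proof -
    have "w ! i < card S" if "i < length w" for i
      using \<open>set w \<subseteq> {..<card S}\<close> that nth_mem by blast
    then have "(i < j \<and> j < l \<and> l < length (map h w) \<and>
          map h w ! i > map h w ! j \<and> map h w ! j > map h w ! l)
        \<longleftrightarrow> (i < j \<and> j < l \<and> l < length w \<and> w ! i > w ! j \<and> w ! j > w ! l)" for i j l
      by (auto simp: less)
    then show ?thesis
      unfolding avoids_321_def by simp
  qed
  have "bij_betw (map h) (lists {..<card S}) (lists S)"
    using bij by (rule bij_lists)
  then have inj: "inj_on (map h) ?T" and img: "map h ` lists {..<card S} = lists S"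
    by (auto simp: bij_betw_def lists_eq_set intro: inj_on_subset)
  have "map h ` ?T = ?S"
  proof (intro equalityI subsetI)
    fix v assume "v \<in> ?S"
    then have "v \<in> map h ` lists {..<card S}"
      unfolding img by (auto simp: lists_eq_set)
    then show "v \<in> map h ` ?T"
      using \<open>v \<in> ?S\<close> avoids by (auto simp: lists_eq_set)
  next
    fix v assume "v \<in> map h ` ?T"
    moreover from this have "v \<in> map h ` lists {..<card S}"
      by (auto simp: lists_eq_set)
    ultimately show "v \<in> ?S"
      unfolding img using avoids by (auto simp: lists_eq_set)
  qed
  then show ?thesis
    using card_image[OF inj] by simp
qed

lemma op_321_inclusion_exclusion:
  "real (op_321 n k) = (\<Sum>m\<le>k. (-1) ^ (k - m) * real (k choose m) *
     real (card {w. length w = n \<and> set w \<subseteq> {..<m} \<and> avoids_321 w}))"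
proof -
  define f :: "nat set \<Rightarrow> real"
    where "f S = card {w. length w = n \<and> set w = S \<and> avoids_321 w}" for S
  define g :: "nat set \<Rightarrow> real"
    where "g S = card {w. length w = n \<and> set w \<subseteq> S \<and> avoids_321 w}" for S
  have "g S = sum f (Pow S)" if "finite S" for S
  proof -
    have "{w. length w = n \<and> set w \<subseteq> S \<and> avoids_321 w} =
        (\<Union>T\<in>Pow S. {w. length w = n \<and> set w = T \<and> avoids_321 w})"
      by auto
    moreover have "finite {w. length w = n \<and> set w = T \<and> avoids_321 w}" if "T \<in> Pow S" for T
      by (rule finite_subset[OF _ finite_words[of S n avoids_321]]) (use that \<open>finite S\<close> in auto)
    ultimately show ?thesis
      unfolding f_def g_def using that by (simp add: card_UN_disjoint disjoint_iff)
  qed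
  then have "f {..<k} = (\<Sum>T\<in>Pow {..<k}. (-1) ^ (card {..<k} - card T) * g T)"
    by (rule inclusion_exclusion_mobius) auto
  also have "\<dots> = (\<Sum>m\<le>k. \<Sum>T | T \<in> Pow {..<k} \<and> card T = m. (-1) ^ (card {..<k} - card T) * g T)"
    by (rule sum.group[symmetric])
      (auto intro: subset_eq_atLeast0_lessThan_card simp: lessThan_atLeast0)
  also have "\<dots> = (\<Sum>m\<le>k. \<Sum>T | T \<in> Pow {..<k} \<and> card T = m. (-1) ^ (k - m) * g {..<m})"
  proof (intro sum.cong refl)
    fix m T assume "T \<in> {T. T \<in> Pow {..<k} \<and> card T = m}"
    then show "(-1) ^ (card {..<k} - card T) * g T = (-1) ^ (k - m) * g {..<m}"
      using card_words_depends_on_card_letters[of T n] by (auto simp: g_def dest: finite_subset)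
  qed
  also have "\<dots> = (\<Sum>m\<le>k. (-1) ^ (k - m) * real (k choose m) * g {..<m})"
    using n_subsets[of "{..<k}"] by (simp add: mult_ac)
  finally show ?thesis
    by (simp add: f_def g_def op_321_eq_card_words)
qed

section \<open>Scanning a word from left to right\<close>

definition avoids_21_below :: "nat \<Rightarrow> nat list \<Rightarrow> bool" where
  "avoids_21_below M w \<longleftrightarrow>
     \<not> (\<exists>i j. i < j \<and> j < length w \<and> M > w ! i \<and> w ! i > w ! j)"

lemma avoids_21_below_Nil [simp]: "avoids_21_below M []"
  by (simp add: avoids_21_below_def)

lemma avoids_321_Nil [simp]: "avoids_321 []"
  by (simp add: avoids_321_def)

lemma avoids_21_below_Cons:
  "avoids_21_below M (y # w) \<longleftrightarrow> (y < M \<longrightarrow> (\<forall>z\<in>set w. y \<le> z)) \<and> avoids_21_below M w"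
    (is "?L \<longleftrightarrow> ?R")
proof
  assume ?L
  then have L: "\<not> (i < j \<and> j < length (y # w) \<and> M > (y # w) ! i \<and> (y # w) ! i > (y # w) ! j)" for i j
    unfolding avoids_21_below_def by blast
  have "y \<le> z" if "y < M" "z \<in> set w" for z
  proof -
    obtain j where "j < length w" "z = w ! j"
      using \<open>z \<in> set w\<close> by (auto simp: in_set_conv_nth)
    then show ?thesis
      using L[of 0 "Suc j"] \<open>y < M\<close> by simp
  qed
  moreover have "\<not> (i < j \<and> j < length w \<and> M > w ! i \<and> w ! i > w ! j)" for i j
    using L[of "Suc i" "Suc j"] by simp
  ultimately show ?R
    unfolding avoids_21_below_def by blast
next
  assume R: ?R
  have "\<not> (i < j \<and> j < length (y # w) \<and> M > (y # w) ! i \<and> (y # w) ! i > (y # w) ! j)" for i j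
  proof (cases i; cases j)
    fix j' assume "i = 0" "j = Suc j'"
    then show ?thesis
      using R nth_mem[of j' w] by (auto simp: not_less)
  next
    fix i' j' assume "i = Suc i'" "j = Suc j'"
    then show ?thesis
      using R by (auto simp: avoids_21_below_def)
  qed auto
  then show ?L
    unfolding avoids_21_below_def by blast
qed

lemma avoids_321_Cons: "avoids_321 (y # w) \<longleftrightarrow> avoids_21_below y w \<and> avoids_321 w"
    (is "?L \<longleftrightarrow> ?R")
proof
  assume L: ?L
  have "\<not> (i < j \<and> j < length w \<and> y > w ! i \<and> w ! i > w ! j)" for i j
    using L[unfolded avoids_321_def not_ex, rule_format, of 0 "Suc i" "Suc j"] by simp
  moreover have "\<not> (i < j \<and> j < l \<and> l < length w \<and> w ! i > w ! j \<and> w ! j > w ! l)" for i j l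
    using L[unfolded avoids_321_def not_ex, rule_format, of "Suc i" "Suc j" "Suc l"] by simp
  ultimately show ?R
    unfolding avoids_321_def avoids_21_below_def by blast
next
  assume R: ?R
  have "\<not> (i < j \<and> j < l \<and> l < length (y # w) \<and>
      (y # w) ! i > (y # w) ! j \<and> (y # w) ! j > (y # w) ! l)" for i j l
  proof (cases i; cases j; cases l)
    fix j' l' assume "i = 0" "j = Suc j'" "l = Suc l'"
    then show ?thesis
      using R by (auto simp: avoids_21_below_def)
  next
    fix i' j' l' assume "i = Suc i'" "j = Suc j'" "l = Suc l'"
    then show ?thesis
      using R by (auto simp: avoids_321_def)
  qed auto
  then show ?L
    unfolding avoids_321_def by blast
qed

text \<open>
  A word is read from left to right. All that the part already read imposes on the rest is recorded
  in two letters: its maximum \<open>M\<close>, and the largest letter \<open>t\<close> that has a larger letter before it.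
  A letter below \<open>t\<close> would complete a 321, one in \<open>{t..<M}\<close> becomes the new \<open>t\<close>, and any
  other becomes the new \<open>M\<close>. While nothing is recorded both are \<open>0\<close>, which forbids nothing.
\<close>
fun scan_ok :: "nat \<Rightarrow> nat \<Rightarrow> nat list \<Rightarrow> bool" where
  "scan_ok t M [] \<longleftrightarrow> True"
| "scan_ok t M (y # w) \<longleftrightarrow> t \<le> y \<and> (if y < M then scan_ok y M w else scan_ok t y w)"

text \<open>
  A 321 that ends in the unread part has two, one or none of its letters in the part already read;
  the three conditions on the right exclude these cases in turn.
\<close>
lemma scan_ok_iff:
  "t \<le> M \<Longrightarrow> scan_ok t M w \<longleftrightarrow> (\<forall>z\<in>set w. t \<le> z) \<and> avoids_21_below M w \<and> avoids_321 w"
proof (induction w arbitrary: t M)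
  case (Cons y w)
  have vacuous: "avoids_21_below y w" if y: "\<forall>z\<in>set w. y \<le> z"
  proof -
    have "\<not> y > w ! i" if "i < length w" for i
      using y that nth_mem by (simp add: leD)
    then show ?thesis
      unfolding avoids_21_below_def by (meson less_trans)
  qed
  have weaken: "avoids_21_below M w" if "avoids_21_below y w" "M \<le> y"
    using that unfolding avoids_21_below_def by (meson less_le_trans)
  show ?case
  proof (cases "y < M")
    case True
    then show ?thesis
      using Cons.IH[of y M] vacuous
      by (auto simp: avoids_21_below_Cons avoids_321_Cons intro: order_trans)
  next
    case False
    then show ?thesis
      using Cons.IH[of t y] Cons.prems weaken by (auto simp: avoids_21_below_Cons avoids_321_Cons)
  qed
qed simp

lemma avoids_321_iff_scan_ok: "avoids_321 w \<longleftrightarrow> scan_ok 0 0 w"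
  by (simp add: scan_ok_iff avoids_21_below_def)

text \<open>
  The number of admissible continuations of length \<open>n\<close> depends on the state only through the number
  \<open>a\<close> of letters in \<open>{t..<M}\<close> and the number \<open>b\<close> of letters above \<open>M\<close>. The first sum is over the
  next letters in \<open>{t..<M}\<close>, indexed by their distance from \<open>M\<close>, the second over those from \<open>M\<close> on.
\<close>
fun continuations :: "nat \<Rightarrow> nat \<Rightarrow> nat \<Rightarrow> nat" where
  "continuations 0 a b = 1"
| "continuations (Suc n) a b =
     (\<Sum>j=1..a. continuations n j b) + (\<Sum>i\<le>b. continuations n (a + i) (b - i))"

lemma card_scan_ok:
  "\<lbrakk>t \<le> M; M < m\<rbrakk> \<Longrightarrow>
     card {w. length w = n \<and> set w \<subseteq> {..<m} \<and> scan_ok t M w} = continuations n (M - t) (m - 1 - M)"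
proof (induction n arbitrary: t M)
  case 0
  have "{w. length w = 0 \<and> set w \<subseteq> {..<m} \<and> scan_ok t M w} = {[]}"
    by auto
  then show ?case
    by simp
next
  case (Suc n)
  define N where "N t M = {w. length w = n \<and> set w \<subseteq> {..<m} \<and> scan_ok t M w}" for t M
  have fin: "finite (N t M)" for t M
    unfolding N_def by (rule finite_words) simp
  have split: "{w. length w = Suc n \<and> set w \<subseteq> {..<m} \<and> scan_ok t M w} =
      (\<Union>y\<in>{t..<M}. (#) y ` N y M) \<union> (\<Union>y\<in>{M..<m}. (#) y ` N t y)" (is "?L = ?R")
  proof (intro equalityI subsetI)
    fix w assume w: "w \<in> ?L"
    then obtain y v where "w = y # v"
      by (cases w) auto
    then show "w \<in> ?R"
      using w by (cases "y < M") (auto simp: N_def)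
  qed (use Suc.prems in \<open>auto simp: N_def\<close>)
  have "card ?L = card (\<Union>y\<in>{t..<M}. (#) y ` N y M) + card (\<Union>y\<in>{M..<m}. (#) y ` N t y)"
    unfolding split by (rule card_Un_disjoint) (auto simp: fin)
  also have "card (\<Union>y\<in>{t..<M}. (#) y ` N y M) = (\<Sum>y\<in>{t..<M}. card (N y M))"
    by (subst card_UN_disjoint) (auto simp: fin card_image)
  also have "\<dots> = (\<Sum>y\<in>{t..<M}. continuations n (M - y) (m - 1 - M))"
    unfolding N_def using Suc.prems by (intro sum.cong refl Suc.IH) auto
  also have "\<dots> = (\<Sum>j=1..M - t. continuations n j (m - 1 - M))"
    by (rule sum.reindex_bij_witness[of _ "\<lambda>j. M - j" "\<lambda>y. M - y"]) (use Suc.prems in auto)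
  also have "card (\<Union>y\<in>{M..<m}. (#) y ` N t y) = (\<Sum>y\<in>{M..<m}. card (N t y))"
    by (subst card_UN_disjoint) (auto simp: fin card_image)
  also have "\<dots> = (\<Sum>y\<in>{M..<m}. continuations n (y - t) (m - 1 - y))"
    unfolding N_def using Suc.prems by (intro sum.cong refl Suc.IH) auto
  also have "\<dots> = (\<Sum>i\<le>m - 1 - M. continuations n (M - t + i) (m - 1 - M - i))"
    by (rule sum.reindex_bij_witness[of _ "\<lambda>i. M + i" "\<lambda>y. y - M"]) (use Suc.prems in auto)
  finally show ?case
    by simp
qed

lemma card_words_avoiding_321:
  "card {w. length w = n \<and> set w \<subseteq> {..<Suc b} \<and> avoids_321 w} = continuations n 0 b"
  using card_scan_ok[of 0 0 "Suc b" n] by (simp add: avoids_321_iff_scan_ok)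

section \<open>The generating function of the central binomial coefficients\<close>

lemma central_binomial_Suc:
  "Suc n * (2 * Suc n choose Suc n) = 2 * (2 * n + 1) * (2 * n choose n)"
proof -
  have "Suc n * (2 * Suc n choose Suc n) = 2 * (Suc n * (2 * n + 1 choose n))"
    using Suc_times_binomial[of n "2 * n + 1"] by simp
  also have "Suc n * (2 * n + 1 choose n) = (2 * n + 1) * (2 * n choose n)"
    using binomial_absorb_comp[of "2 * n + 1" n] by simp
  finally show ?thesis
    by (simp only: mult.assoc)
qed

text \<open>
  This is \<open>(1 - 4 c X) powr (-1/2)\<close>; the next two lemmas are its differential equation and its
  defining equation. The coefficients lie in a general ring because below \<open>c\<close> is itself a power series.
\<close>
definition central_binomial_fps :: "'a::comm_ring_1 \<Rightarrow> 'a fps" where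
  "central_binomial_fps c = Abs_fps (\<lambda>n. of_nat (2 * n choose n) * c ^ n)"

lemma deriv_central_binomial_fps:
  "fps_deriv (central_binomial_fps c) * (1 - fps_const (4 * c) * fps_X) =
     fps_const (2 * c) * central_binomial_fps c"
proof (rule fps_ext)
  fix n
  have *: "(of_nat (Suc n) * of_nat (2 * Suc n choose Suc n) :: 'a) =
      2 * (2 * of_nat n + 1) * of_nat (2 * n choose n)"
    using arg_cong[OF central_binomial_Suc[of n], of "of_nat :: nat \<Rightarrow> 'a"]
    by (simp add: algebra_simps)
  have "(fps_deriv (central_binomial_fps c) * (1 - fps_const (4 * c) * fps_X)) $ n =
      (of_nat (Suc n) * of_nat (2 * Suc n choose Suc n)) * c ^ Suc n
        - 4 * c * of_nat n * of_nat (2 * n choose n) * c ^ n"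
    by (cases n) (simp_all add: central_binomial_fps_def algebra_simps)
  also have "\<dots> = (fps_const (2 * c) * central_binomial_fps c) $ n"
    unfolding * by (simp add: central_binomial_fps_def algebra_simps)
  finally show "(fps_deriv (central_binomial_fps c) * (1 - fps_const (4 * c) * fps_X)) $ n = \<dots>" .
qed

text \<open>By the differential equation the left-hand side has derivative zero.\<close>
lemma central_binomial_fps_square:
  fixes c :: "'a::{idom,semiring_char_0}"
  shows "central_binomial_fps c ^ 2 * (1 - fps_const (4 * c) * fps_X) = 1"
proof -
  let ?A = "central_binomial_fps c" and ?L = "1 - fps_const (4 * c) * fps_X"
  have "fps_deriv (?A ^ 2 * ?L) = ?A * (2 * (fps_deriv ?A * ?L) - fps_const (4 * c) * ?A)"
    by (simp add: power2_eq_square algebra_simps)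
  also have "\<dots> = 0"
    unfolding deriv_central_binomial_fps by (simp add: algebra_simps fps_numeral_fps_const)
  finally have "?A ^ 2 * ?L = fps_const ((?A ^ 2 * ?L) $ 0)"
    by (simp only: fps_deriv_eq_0_iff)
  then show ?thesis
    by (simp add: central_binomial_fps_def fps_power_zeroth)
qed

section \<open>The generating function of the closed formula\<close>

text \<open>
  The claimed number of 321-avoiding words of length \<open>n\<close> over \<open>b + 1\<close> letters. The double sum starts
  with two letters, and over one letter there is a single word.
\<close>
definition word_formula :: "nat \<Rightarrow> nat \<Rightarrow> real" where
  "word_formula b n = (case b of 0 \<Rightarrow> 1 | Suc j \<Rightarrow> 2 powi (int n - 2 * int j) *
      (\<Sum>i\<le>j. (2 * real j - 2 * real i + 1) / (real j + 1) *
        real ((2 * i) choose i) * real ((2 * (j - i)) choose (j - i)) *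
        real ((n + 2 * i) choose (2 * i))))"

lemma word_formula_0: "word_formula 0 = (\<lambda>_. 1)"
  by (simp add: word_formula_def fun_eq_iff)

text \<open>
  Two variables are needed: \<open>X\<close> marks the length of a word and \<open>Y\<close> the letters beyond the first in
  its alphabet. Series in both are series in \<open>Y\<close> whose coefficients are series in \<open>X\<close>; \<open>cX\<close> is \<open>X\<close> seen as such a
  series.
\<close>
abbreviation X :: "real fps" where "X \<equiv> fps_X"
abbreviation cX :: "real fps fps" where "cX \<equiv> fps_const fps_X"
abbreviation Y :: "real fps fps" where "Y \<equiv> fps_X"

definition words_fps :: "real fps fps" where
  "words_fps = Abs_fps (\<lambda>b. Abs_fps (word_formula b))"

definition q_fps :: "real fps" where
  "q_fps = X * (1 - X)"

definition doubling_fps :: "real fps" where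
  "doubling_fps = Abs_fps (\<lambda>n. 2 ^ n)"

abbreviation quarter :: "real fps" where
  "quarter \<equiv> fps_const (1 / 4)"

text \<open>
  With \<open>z = 1 / (1 - 2 X)\<^sup>2\<close>, the square of \<open>doubling_fps\<close>, these are the power series of \<open>(1 - Y) powr (-1/2)\<close>,
  \<open>(1 - z Y) powr (-1/2)\<close> and \<open>(1 - Y) powr (-3/2)\<close>.
\<close>
abbreviation inv_root :: "real fps fps" where
  "inv_root \<equiv> central_binomial_fps quarter"
abbreviation inv_root_z :: "real fps fps" where
  "inv_root_z \<equiv> central_binomial_fps (quarter * doubling_fps ^ 2)"
definition inv_root_cubed :: "real fps fps" where
  "inv_root_cubed = Abs_fps (\<lambda>p. of_nat ((2 * p + 1) * (2 * p choose p)) * quarter ^ p)"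

lemma doubling_fps_inverse: "doubling_fps * (1 - 2 * X) = 1"
proof (rule fps_ext)
  show "(doubling_fps * (1 - 2 * X)) $ n = 1 $ n" for n
    by (cases n) (simp_all add: doubling_fps_def algebra_simps fps_numeral_fps_const)
qed

lemma doubling_fps_power_nth:
  "(doubling_fps ^ (2 * i + 1)) $ n = 2 ^ n * real ((n + 2 * i) choose (2 * i))"
proof -
  let ?L = "1 - fps_const 2 * X"
  have "inverse (?L ^ (2 * i + 1)) = Abs_fps (\<lambda>k. of_nat (2 * i + 1 + k - 1 choose k) * 2 ^ k)"
    by (rule one_minus_const_fps_X_neg_power') simp
  moreover have "doubling_fps ^ (2 * i + 1) = inverse (?L ^ (2 * i + 1))"
  proof (rule fps_inverse_unique[symmetric])
    have "?L ^ (2 * i + 1) * doubling_fps ^ (2 * i + 1) = (doubling_fps * (1 - 2 * X)) ^ (2 * i + 1)"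
      by (simp only: power_mult_distrib mult.commute fps_numeral_fps_const)
    then show "?L ^ (2 * i + 1) * doubling_fps ^ (2 * i + 1) = 1"
      by (simp only: doubling_fps_inverse power_one)
  qed
  moreover have "(2 * i + n choose n) = (n + 2 * i choose (2 * i))"
    using binomial_symmetric[of n "2 * i + n"] by (simp add: add.commute)
  ultimately show ?thesis
    by simp
qed

lemma one_minus_Y_nonzero: "1 - Y \<noteq> 0"
proof
  assume "1 - Y = 0"
  then have "(1 - Y) $ 0 = 0"
    by simp
  then show False
    by simp
qed

lemma inv_root_cubed: "inv_root_cubed * (1 - Y) = inv_root"
proof -
  have "inv_root_cubed = 2 * Y * fps_deriv inv_root + inv_root"
  proof (rule fps_ext)
    show "inv_root_cubed $ n = (2 * Y * fps_deriv inv_root + inv_root) $ n" for n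
      by (cases n) (simp_all add: inv_root_cubed_def central_binomial_fps_def mult.assoc
          fps_numeral_fps_const algebra_simps)
  qed
  moreover have "fps_deriv inv_root * (1 - Y) = fps_const (2 * quarter) * inv_root"
    using deriv_central_binomial_fps[of quarter] by (simp add: fps_numeral_fps_const)
  moreover have "2 * fps_const (2 * quarter) = 1"
    by (simp add: fps_numeral_fps_const)
  ultimately show ?thesis
    by algebra
qed

lemma deriv_inv_root: "fps_deriv inv_root = fps_const (2 * quarter) * inv_root_cubed"
proof -
  have "fps_deriv inv_root * (1 - Y) = fps_const (2 * quarter) * inv_root"
    using deriv_central_binomial_fps[of quarter] by (simp add: fps_numeral_fps_const)
  also have "\<dots> = fps_const (2 * quarter) * inv_root_cubed * (1 - Y)"
    by (simp only: inv_root_cubed[symmetric] mult.assoc)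
  finally show ?thesis
    using one_minus_Y_nonzero by (simp only: mult_cancel_right) simp
qed

text \<open>
  The inner sum of the closed formula is a Cauchy product: the binomials in \<open>i\<close> and in \<open>j - i\<close> are
  coefficients of two separate series, and \<open>(n + 2 i choose 2 i)\<close> is a coefficient of the odd
  power \<open>2 i + 1\<close> of \<open>1 / (1 - 2 X)\<close>. Differentiating in \<open>Y\<close> removes the remaining
  denominator \<open>j + 1\<close>.
\<close>
lemma deriv_words_fps:
  "fps_deriv words_fps = fps_const doubling_fps * inv_root_z * inv_root_cubed" (is "_ = ?P")
proof (rule fps_ext)
  fix j
  define t where "t i = real (2 * i choose i) * (real (2 * (j - i)) + 1) *
    real (2 * (j - i) choose (j - i)) / 4 ^ j" for i
  have product: "?P $ j = (\<Sum>i\<le>j. fps_const (t i) * doubling_fps ^ (2 * i + 1))"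
    unfolding mult.assoc fps_mult_left_const_nth unfolding fps_mult_nth sum_distrib_left
  proof (rule sum.cong)
    fix i assume "i \<in> {..j}"
    then obtain p where j: "j = i + p"
      using le_Suc_ex by auto
    define d e where "d = real (2 * i choose i)" and "e = (2 * real p + 1) * real (2 * p choose p)"
    have "quarter ^ i * quarter ^ p = fps_const (1 / 4 ^ j)"
      by (simp add: j fps_const_power power_add power_divide)
    moreover have "inv_root_z $ i = fps_const d * (quarter ^ i * doubling_fps ^ (2 * i))"
      by (simp add: central_binomial_fps_def d_def power_mult_distrib fps_of_nat power_mult
          del: fps_const_power)
    moreover have "inv_root_cubed $ p = fps_const e * quarter ^ p"
      by (simp add: inv_root_cubed_def e_def algebra_simps flip: fps_of_nat del: fps_const_power)
    ultimately have "doubling_fps * (inv_root_z $ i * inv_root_cubed $ p) =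
        fps_const d * fps_const e * fps_const (1 / 4 ^ j) * (doubling_fps ^ (2 * i) * doubling_fps)"
      by (simp only: mult_ac)
    also have "\<dots> = fps_const (d * e / 4 ^ j) * doubling_fps ^ (2 * i + 1)"
      by simp
    finally show "doubling_fps * (inv_root_z $ i * inv_root_cubed $ (j - i)) =
        fps_const (t i) * doubling_fps ^ (2 * i + 1)"
      by (simp add: t_def j d_def e_def mult.assoc)
  qed auto
  show "fps_deriv words_fps $ j = ?P $ j"
  proof (rule fps_ext)
    fix n
    have "2 powi (int n - 2 * int j) = (2 ^ n / 4 ^ j :: real)"
      by (simp add: power_int_diff power_int_mult)
    then have "word_formula (Suc j) n = 2 ^ n / 4 ^ j *
        (\<Sum>i\<le>j. (2 * real j - 2 * real i + 1) / (real j + 1) *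
          real ((2 * i) choose i) * real ((2 * (j - i)) choose (j - i)) *
          real ((n + 2 * i) choose (2 * i)))"
      by (simp only: word_formula_def nat.case)
    moreover have "t i * (2 ^ n * real ((n + 2 * i) choose (2 * i))) =
        (real j + 1) * (2 ^ n / 4 ^ j * ((2 * real j - 2 * real i + 1) / (real j + 1) *
          real ((2 * i) choose i) * real ((2 * (j - i)) choose (j - i)) *
          real ((n + 2 * i) choose (2 * i))))" if "i \<le> j" for i
    proof -
      have "real j + 1 \<noteq> 0"
        by linarith
      then show ?thesis
        using that by (simp add: t_def of_nat_diff)
    qed
    ultimately have "(\<Sum>i\<le>j. t i * (2 ^ n * real ((n + 2 * i) choose (2 * i)))) =
        (real j + 1) * word_formula (Suc j) n"
      by (simp add: sum_distrib_left)
    also have "\<dots> = (fps_deriv words_fps $ j) $ n"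
      by (simp add: words_fps_def algebra_simps)
    finally show "(fps_deriv words_fps $ j) $ n = (?P $ j) $ n"
      by (simp only: product fps_sum_nth fps_mult_left_const_nth doubling_fps_power_nth)
  qed
qed

lemma doubling_fps_inverse_const: "fps_const doubling_fps * fps_const (1 - 2 * X) = 1"
  by (simp only: fps_const_mult doubling_fps_inverse fps_const_1_eq_1)

lemma square_one_minus_2X: "fps_const (1 - 2 * X) ^ 2 = 1 - 4 * fps_const q_fps"
  unfolding q_fps_def
  by (simp add: fps_const_power fps_numeral_fps_const power2_eq_square algebra_simps
      flip: fps_const_add fps_const_sub)

text \<open>
  Integrating the previous lemma: the right-hand side is \<open>(1 - 2 X) * sqrt ((1 - z Y) / (1 - Y))\<close>,
  and both sides have the same derivative and the same constant coefficient.
\<close>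
lemma discriminant_root_words_fps:
  "1 - 2 * fps_const q_fps * words_fps =
     fps_const (1 - 2 * X) * (1 - fps_const (doubling_fps ^ 2) * Y) * inv_root_z * inv_root"
  (is "?D = ?R")
proof -
  let ?Z = "1 - fps_const (doubling_fps ^ 2) * Y"
  define U V Q C0 C1
    where "U = fps_const (1 - 2 * X)" and "V = fps_const doubling_fps" and "Q = fps_const q_fps"
      and "C0 = fps_const quarter" and "C1 = fps_const (quarter * doubling_fps ^ 2)"
  have UV: "V * U = 1"
    unfolding U_def V_def by (rule doubling_fps_inverse_const)
  have UQ: "U ^ 2 = 1 - 4 * Q"
    unfolding U_def Q_def by (rule square_one_minus_2X)
  have C0: "4 * C0 = 1"
    by (simp add: C0_def fps_numeral_fps_const)
  have C1: "C1 = C0 * V ^ 2"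
    by (simp add: C0_def C1_def V_def fps_const_power)
  have Z: "?Z = 1 - 4 * C1 * Y"
    by (simp add: C1_def fps_numeral_fps_const flip: mult.assoc)
  have dA: "fps_deriv inv_root_z * ?Z = 2 * C1 * inv_root_z"
    using deriv_central_binomial_fps[of "quarter * doubling_fps ^ 2"]
    unfolding Z C1_def by (simp add: fps_numeral_fps_const)
  have dE: "fps_deriv inv_root = 2 * C0 * inv_root_cubed"
    unfolding deriv_inv_root C0_def by (simp add: fps_numeral_fps_const)
  have dU: "fps_deriv U = 0" and dC1: "fps_deriv C1 = 0"
    unfolding U_def C1_def by (rule fps_deriv_const)+
  have E: "inv_root = inv_root_cubed * (1 - Y)"
    by (simp only: inv_root_cubed)
  have "fps_deriv ?D = - 2 * Q * (V * inv_root_z * inv_root_cubed)"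
    by (simp add: Q_def V_def deriv_words_fps)
  also have "\<dots> = U * (- 4 * C1 * inv_root_z * inv_root + (fps_deriv inv_root_z * ?Z) * inv_root
      + ?Z * inv_root_z * fps_deriv inv_root)"
    unfolding dA dE unfolding Z using UV UQ C0 C1 E by algebra
  also have "\<dots> = fps_deriv ?R"
    unfolding Z U_def[symmetric] by (simp add: dU dC1 algebra_simps)
  finally have "?D = fps_const (?D $ 0 - ?R $ 0) + ?R"
    by (simp only: fps_deriv_eq_iff)
  moreover have "?D $ 0 = ?R $ 0"
  proof -
    have "(1 - X) * words_fps $ 0 = 1"
      by (intro fps_ext) (simp add: words_fps_def word_formula_0 algebra_simps)
    then have "q_fps * words_fps $ 0 = X"
      by (simp add: q_fps_def mult.assoc)
    then show ?thesis
      by (simp add: central_binomial_fps_def fps_numeral_fps_const mult.assoc)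
  qed
  ultimately show ?thesis
    by simp
qed

text \<open>
  Squaring removes the roots. So \<open>words_fps\<close> is \<open>1 / (1 - Y)\<close> times the Catalan series at
  \<open>q / (1 - Y)\<close>, where \<open>q = X (1 - X)\<close>.
\<close>
lemma words_fps_quadratic: "words_fps * (1 - Y) = 1 + fps_const q_fps * words_fps ^ 2 * (1 - Y)"
proof -
  define U V Q
    where "U = fps_const (1 - 2 * X)" and "V = fps_const doubling_fps" and "Q = fps_const q_fps"
  have UV: "V * U = 1"
    unfolding U_def V_def by (rule doubling_fps_inverse_const)
  have UQ: "U ^ 2 = 1 - 4 * Q"
    unfolding U_def Q_def by (rule square_one_minus_2X)
  have Z: "fps_const (doubling_fps ^ 2) = V ^ 2"
    by (simp add: V_def fps_const_power)
  have A: "inv_root_z ^ 2 * (1 - V ^ 2 * Y) = 1"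
    using central_binomial_fps_square[of "quarter * doubling_fps ^ 2"]
    unfolding Z[symmetric] by (simp add: fps_numeral_fps_const flip: mult.assoc)
  have E: "inv_root ^ 2 * (1 - Y) = 1"
    using central_binomial_fps_square[of quarter] by (simp add: fps_numeral_fps_const)
  have "1 - 2 * Q * words_fps = U * (1 - V ^ 2 * Y) * inv_root_z * inv_root"
    unfolding U_def Q_def Z[symmetric] by (rule discriminant_root_words_fps)
  then have "(1 - 2 * Q * words_fps) ^ 2 * (1 - Y) = U ^ 2 - Y"
    using A E UV by algebra
  then have "4 * Q * (words_fps * (1 - Y)) = 4 * Q * (1 + Q * words_fps ^ 2 * (1 - Y))"
    using UQ by algebra
  moreover have "4 * Q \<noteq> 0"
  proof -
    have "q_fps $ 1 = 1"
      by (simp add: q_fps_def)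
    then have "q_fps \<noteq> 0"
      by auto
    then show ?thesis
      by (simp add: Q_def)
  qed
  ultimately show ?thesis
    by (simp add: Q_def)
qed

section \<open>Solving the scanning recurrence\<close>

lemma fps_nth_continuations:
  fixes \<Phi> :: "nat \<Rightarrow> real fps fps"
  assumes "\<And>a b. \<Phi> a $ b = 1 + X * (\<Sum>j=1..a. \<Phi> j $ b) + X * (\<Sum>i\<le>b. \<Phi> (a + i) $ (b - i))"
  shows "\<Phi> a $ b $ n = real (continuations n a b)"
proof (induction n arbitrary: a b)
  case 0
  show ?case
    by (subst assms) simp
next
  case (Suc n)
  show ?case
    by (subst assms) (simp add: fps_sum_nth Suc.IH)
qed

lemma geometric_fps: "Abs_fps (\<lambda>_. 1) * (1 - fps_X) = (1 :: 'a::comm_ring_1 fps)"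
  by (rule fps_ext) (simp add: algebra_simps)

text \<open>
  The recurrence for \<open>continuations\<close> has constant coefficients in \<open>a\<close>, so solutions are sought among
  the series \<open>\<rho> ^ a\<close>. The tail sum of such a solution contributes the factor
  \<open>K = 1 / (1 - Y \<rho>)\<close>, which is the first equation; subtracting the recurrence at \<open>a\<close> from the one
  at \<open>a + 1\<close> gives the second, which is quadratic in \<open>\<rho>\<close> once \<open>K\<close> is eliminated. Together they
  determine the power series \<open>\<rho>\<close> and \<open>K\<close>, and because of the quadratic equation of \<open>words_fps\<close>
  the value of \<open>K\<close> is \<open>(1 - X) * words_fps\<close>.
\<close>
lemma kernel_root:
  defines "K \<equiv> fps_const (1 - X) * words_fps"
  obtains \<rho> where "K = 1 + Y * \<rho> * K" and "(\<rho> - 1) * (1 - cX * K) = cX * \<rho>" and "K $ 0 = 1"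
proof -
  define R where "R = fps_const (1 - X)"
  define J where "J = fps_const (Abs_fps (\<lambda>_. 1) :: real fps)"
  define Q where "Q = fps_const q_fps"
  have RJ: "R * J = 1"
    unfolding R_def J_def fps_const_mult by (simp add: mult.commute geometric_fps)
  have RJ0: "R $ 0 * J $ 0 = 1"
    using arg_cong[OF RJ, of "\<lambda>f. f $ 0"] by simp
  have QR: "Q = cX * R"
    by (simp add: Q_def R_def q_fps_def)
  have R: "R = 1 - cX"
    by (simp add: R_def flip: fps_const_sub)
  have quad: "words_fps * (1 - Y) = 1 + Q * words_fps ^ 2 * (1 - Y)"
    unfolding Q_def by (rule words_fps_quadratic)
  have K_eq: "K = R * words_fps"
    by (simp add: K_def R_def)
  have K0: "K $ 0 = 1"
    using RJ0 by (simp add: K_eq R_def J_def words_fps_def word_formula_0)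
  \<comment> \<open>By the quadratic equation \<open>1 / K\<close> is \<open>(1 - Y) * (1 - cX * K) / (1 - X)\<close>, so \<open>L\<close> is the
      value \<open>1 - 1 / K\<close> that \<open>Y * \<rho>\<close> must have.\<close>
  define L where "L = 1 - (1 - Y) * (1 - cX * K) * J"
  define \<rho> where "\<rho> = fps_shift 1 L"
  have "L $ 0 = 0"
    using RJ0 by (simp add: L_def K0 R_def mult.commute)
  then have L: "Y * \<rho> = L"
    unfolding \<rho>_def by (intro fps_ext) simp
  have K: "K = 1 + Y * \<rho> * K"
    unfolding L L_def using quad RJ QR K_eq by algebra
  have "Y * K * ((\<rho> - 1) * (1 - cX * K)) = Y * K * (cX * \<rho>)"
    using K quad QR K_eq R by algebra
  moreover have "Y * K \<noteq> 0"
    using K0 by auto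
  ultimately have "(\<rho> - 1) * (1 - cX * K) = cX * \<rho>"
    by (simp only: mult_cancel_left) simp
  from K this K0 show thesis
    by (rule that[of \<rho>])
qed

text \<open>
  The series \<open>words_fps * \<rho> ^ a\<close> satisfy the recurrence of \<open>continuations\<close>; the case \<open>a = 0\<close> of that
  recurrence is the quadratic equation again.
\<close>
lemma word_formula_eq_continuations: "word_formula b n = real (continuations n 0 b)"
proof -
  define K where "K = fps_const (1 - X) * words_fps"
  obtain \<rho> where K: "K = 1 + Y * \<rho> * K" and \<rho>: "(\<rho> - 1) * (1 - cX * K) = cX * \<rho>"
    and K0: "K $ 0 = 1"
    unfolding K_def by (rule kernel_root)
  define \<Phi> where "\<Phi> a = words_fps * \<rho> ^ a" for a
  have \<Phi>_Suc: "\<Phi> (Suc a) = \<rho> * \<Phi> a" for a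
    by (simp add: \<Phi>_def)
  have tail: "(\<Phi> a * K) $ b = (\<Sum>i\<le>b. \<Phi> (a + i) $ (b - i))" for a b
  proof (induction b arbitrary: a)
    case 0
    show ?case
      by (simp add: K0)
  next
    case (Suc b)
    have "\<Phi> a * K = \<Phi> a * (1 + Y * \<rho> * K)"
      using K by simp
    also have "\<dots> = \<Phi> a + Y * (\<Phi> (Suc a) * K)"
      by (simp add: \<Phi>_Suc algebra_simps)
    finally have "(\<Phi> a * K) $ Suc b = \<Phi> a $ Suc b + (\<Phi> (Suc a) * K) $ b"
      by simp
    then show ?case
      unfolding Suc.IH sum.atMost_Suc_shift by simp
  qed
  define O1 :: "real fps fps" where "O1 = Abs_fps (\<lambda>_. 1)"
  have O1: "O1 * (1 - Y) = 1"
    unfolding O1_def by (rule geometric_fps)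
  have rec: "\<Phi> a = O1 + cX * (\<Sum>j=1..a. \<Phi> j) + cX * (\<Phi> a * K)" for a
  proof (induction a)
    case 0
    have "fps_const q_fps * words_fps = cX * K"
      by (simp add: K_def q_fps_def flip: mult.assoc)
    then have "words_fps = O1 + cX * (words_fps * K)"
      using O1 words_fps_quadratic by algebra
    then show ?case
      by (simp add: \<Phi>_def)
  next
    case (Suc a)
    have "\<Phi> (Suc a) - \<Phi> a = cX * \<Phi> (Suc a) + cX * (\<Phi> (Suc a) * K) - cX * (\<Phi> a * K)"
      using \<Phi>_Suc[of a] \<rho> by algebra
    then have "\<Phi> (Suc a) = O1 + cX * ((\<Sum>j=1..a. \<Phi> j) + \<Phi> (Suc a)) + cX * (\<Phi> (Suc a) * K)"
      using Suc.IH by algebra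
    then show ?case
      by simp
  qed
  have "\<Phi> a $ b = 1 + X * (\<Sum>j=1..a. \<Phi> j $ b) + X * (\<Sum>i\<le>b. \<Phi> (a + i) $ (b - i))" for a b
    by (subst rec) (simp add: O1_def fps_sum_nth tail)
  from fps_nth_continuations[OF this, of 0 b n] show ?thesis
    by (simp add: \<Phi>_def words_fps_def)
qed

section \<open>The formula for ordered partitions\<close>

theorem theorem3p5:
  fixes n k :: nat
  assumes "1 \<le> k" and "k \<le> n"
  shows "real (op_321 n k) =
    (-1) ^ (k - 1) * real k +
    (\<Sum>j<k - 1. (-1) ^ (k - j) * real (k choose (j + 2)) * 2 powi (int n - 2 * int j) *
      (\<Sum>i\<le>j. (2 * real j - 2 * real i + 1) / (real j + 1) *
        real ((2 * i) choose i) * real ((2 * (j - i)) choose (j - i)) *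
        real ((n + 2 * i) choose (2 * i))))"
proof -
  obtain k' where k': "k = Suc k'"
    using assms(1) by (cases k) auto
  define W where "W m = real (card {w. length w = n \<and> set w \<subseteq> {..<m} \<and> avoids_321 w})" for m
  define g where "g m = (-1) ^ (k - m) * real (k choose m) * W m" for m
  have W0: "W 0 = 0"
  proof -
    have "{w. length w = n \<and> set w \<subseteq> {..<0} \<and> avoids_321 w} = {}"
      using assms by auto
    then show ?thesis
      by (simp add: W_def)
  qed
  have W: "W (Suc b) = word_formula b n" for b
    unfolding W_def word_formula_eq_continuations card_words_avoiding_321 ..
  have "real (op_321 n k) = (\<Sum>m\<le>k. g m)"
    unfolding g_def W_def by (rule op_321_inclusion_exclusion)
  also have "\<dots> = g 0 + (g (Suc 0) + (\<Sum>j<k - 1. g (Suc (Suc j))))"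
    by (simp add: k' sum.atMost_shift sum.lessThan_Suc_shift del: sum.lessThan_Suc)
  also have "g 0 = 0"
    by (simp add: g_def W0)
  also have "g (Suc 0) = (-1) ^ (k - 1) * real k"
    by (simp add: g_def W word_formula_0)
  also have "(\<Sum>j<k - 1. g (Suc (Suc j))) =
    (\<Sum>j<k - 1. (-1) ^ (k - j) * real (k choose (j + 2)) * 2 powi (int n - 2 * int j) *
      (\<Sum>i\<le>j. (2 * real j - 2 * real i + 1) / (real j + 1) *
        real ((2 * i) choose i) * real ((2 * (j - i)) choose (j - i)) *
        real ((n + 2 * i) choose (2 * i))))"
  proof (rule sum.cong)
    fix j assume "j \<in> {..<k - 1}"
    then have "k - j = Suc (Suc (k - Suc (Suc j)))"
      by auto
    then have "(-1 :: real) ^ (k - Suc (Suc j)) = (-1) ^ (k - j)"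
      by simp
    then show "g (Suc (Suc j)) = (-1) ^ (k - j) * real (k choose (j + 2)) *
      2 powi (int n - 2 * int j) * (\<Sum>i\<le>j. (2 * real j - 2 * real i + 1) / (real j + 1) *
        real ((2 * i) choose i) * real ((2 * (j - i)) choose (j - i)) *
        real ((n + 2 * i) choose (2 * i)))"
      by (simp add: g_def W word_formula_def)
  qed simp
  finally show ?thesis
    by simp
qed

end
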